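(* There exist a planar graph $G$ of girth $4$ and a signature $\sigma: E(G)\to\{1,-1\}$ such that the signed graph $(G,\sigma)$ is not $3$-choosable, but the unsigned graph $G$ is $3$-choosable.
   Context: All graphs are finite and simple. The girth of a graph is the length of a shortest cycle. A signed graph is a pair $(G,\sigma)$ where $G$ is a graph and $\sigma: E(G)\to\{1,-1\}$ is a mapping, called a signature of $G$. A proper coloring of $(G,\sigma)$ is a map $c: V(G)\to\mathbb{Z}$ such that $c(u)\neq \sigma(uv)\,c(v)$ for every edge $uv\in E(G)$. A list-assignment is a function $L$ on $V(G)$ with $\emptyset\neq L(v)\subseteq\mathbb{Z}$ for each $v\in V(G)$; it is a $k$-list-assignment if $|L(v)|=k$ for every $v\in V(G)$. An $L$-coloring is a proper coloring $c$ of $(G,\sigma)$ with $c(v)\in L(v)$ for every $v\in V(G)$. $(G,\sigma)$ is $k$-choosable if it has an $L$-coloring for every $k$-list-assignment $L$. The unsigned graph $G$ is $k$-choosable in the usual sense, i.e. for every $k$-list-assignment $L$ there is a map $c$ with $c(v)\in L(v)$ for all $v$ and $c(u)\ne c(v)$ for every edge $uv$ (equivalently, the signed graph with all edges of sign $1$ is $k$-choosable). *)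

theory Defs
  imports
    "HOL-Analysis.Analysis"
    "HOL-Library.Extended_Nat"
    "Graph_Theory.Pair_Digraph"
begin

text \<open>
  Finite simple graphs are the symmetric loop-free digraphs of locale \<^locale>\<open>pair_graph\<close>:
  an undirected edge \<open>uv\<close> is the pair of arcs \<open>(u,v)\<close>, \<open>(v,u)\<close>. Data attached to
  undirected edges (signs, drawings) is indexed by the two-element set \<open>{u,v}\<close>.
\<close>

definition edges :: "'a pair_pre_digraph \<Rightarrow> 'a set set" where
  "edges G = {{u, v} | u v. (u, v) \<in> parcs G}"

text \<open>
  The bound \<open>3 \<le> length p\<close> excludes the closed walks \<open>u, v, u\<close> along a single edge, which
  are cycles of the symmetric digraph. An acyclic graph has girth \<open>\<infinity>\<close>, as the infimum of
  the empty set in \<^typ>\<open>enat\<close>.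
\<close>

definition graph_cycle :: "'a pair_pre_digraph \<Rightarrow> ('a \<times> 'a) list \<Rightarrow> bool" where
  "graph_cycle G p \<longleftrightarrow> pre_digraph.cycle (with_proj G) p \<and> 3 \<le> length p"

definition girth :: "'a pair_pre_digraph \<Rightarrow> enat" where
  "girth G = (INF p \<in> {p. graph_cycle G p}. enat (length p))"

text \<open>
  A drawing in the plane \<^typ>\<open>complex\<close>: vertices are distinct points, each edge is an arc
  between its two ends, and the interior of an edge contains no vertex and no point of any
  other edge.
\<close>

definition plane_embedding ::
  "'a pair_pre_digraph \<Rightarrow> ('a \<Rightarrow> complex) \<Rightarrow> ('a set \<Rightarrow> real \<Rightarrow> complex) \<Rightarrow> bool" where
  "plane_embedding G pt \<gamma> \<longleftrightarrow>
     inj_on pt (pverts G) \<and>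
     (\<forall>e \<in> edges G. arc (\<gamma> e) \<and> {pathstart (\<gamma> e), pathfinish (\<gamma> e)} = pt ` e) \<and>
     (\<forall>e \<in> edges G. (path_image (\<gamma> e) - pt ` e) \<inter> pt ` pverts G = {}) \<and>
     (\<forall>e \<in> edges G. \<forall>f \<in> edges G. e \<noteq> f \<longrightarrow>
        (path_image (\<gamma> e) - pt ` e) \<inter> path_image (\<gamma> f) = {})"

definition planar :: "'a pair_pre_digraph \<Rightarrow> bool" where
  "planar G \<longleftrightarrow> (\<exists>pt \<gamma>. plane_embedding G pt \<gamma>)"

definition signature :: "'a pair_pre_digraph \<Rightarrow> ('a set \<Rightarrow> int) \<Rightarrow> bool" where
  "signature G \<sigma> \<longleftrightarrow> (\<forall>e \<in> edges G. \<sigma> e \<in> {1, -1})"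

definition signed_proper_coloring ::
  "'a pair_pre_digraph \<Rightarrow> ('a set \<Rightarrow> int) \<Rightarrow> ('a \<Rightarrow> int) \<Rightarrow> bool" where
  "signed_proper_coloring G \<sigma> c \<longleftrightarrow> (\<forall>(u, v) \<in> parcs G. c u \<noteq> \<sigma> {u, v} * c v)"

definition proper_coloring :: "'a pair_pre_digraph \<Rightarrow> ('a \<Rightarrow> int) \<Rightarrow> bool" where
  "proper_coloring G c \<longleftrightarrow> (\<forall>(u, v) \<in> parcs G. c u \<noteq> c v)"

definition list_assignment :: "'a pair_pre_digraph \<Rightarrow> ('a \<Rightarrow> int set) \<Rightarrow> bool" where
  "list_assignment G L \<longleftrightarrow> (\<forall>v \<in> pverts G. L v \<noteq> {})"

definition k_list_assignment :: "nat \<Rightarrow> 'a pair_pre_digraph \<Rightarrow> ('a \<Rightarrow> int set) \<Rightarrow> bool" where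
  "k_list_assignment k G L \<longleftrightarrow>
     list_assignment G L \<and> (\<forall>v \<in> pverts G. finite (L v) \<and> card (L v) = k)"

definition signed_choosable :: "nat \<Rightarrow> 'a pair_pre_digraph \<Rightarrow> ('a set \<Rightarrow> int) \<Rightarrow> bool" where
  "signed_choosable k G \<sigma> \<longleftrightarrow>
     (\<forall>L. k_list_assignment k G L \<longrightarrow>
        (\<exists>c. signed_proper_coloring G \<sigma> c \<and> (\<forall>v \<in> pverts G. c v \<in> L v)))"

definition choosable :: "nat \<Rightarrow> 'a pair_pre_digraph \<Rightarrow> bool" where
  "choosable k G \<longleftrightarrow>
     (\<forall>L. k_list_assignment k G L \<longrightarrow>
        (\<exists>c. proper_coloring G c \<and> (\<forall>v \<in> pverts G. c v \<in> L v)))"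

lemma choosable_iff_all_positive: "choosable k G \<longleftrightarrow> signed_choosable k G (\<lambda>_. 1)"
  by (simp add: choosable_def signed_choosable_def proper_coloring_def signed_proper_coloring_def)

end

theory Submission
  imports Defs
begin

text \<open>
  The graph consists of nine cubes glued along a pair of opposite vertices \<open>0\<close>, \<open>1\<close> of one
  face \<open>0 2 1 3\<close>; the opposite face of each cube is a cycle \<open>4 5 6 7\<close>. In the signed graph this
  cycle carries exactly one negative edge, so it has no coloring from the lists \<open>{1, -1}\<close>.
  The lists of \<open>0\<close> and \<open>1\<close> are disjoint, and each of the nine pairs \<open>(a, b)\<close> of colors for them
  is blocked by one cube: there the lists \<open>{a, b, 8}\<close> force color \<open>8\<close> on \<open>2\<close> and \<open>3\<close>, and the
  lists of \<open>4, 5, 6, 7\<close> all shrink to \<open>{1, -1}\<close>. Without signs, every coloring of \<open>0\<close> and \<open>1\<close>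
  extends to \<open>2\<close> and \<open>3\<close> and then to \<open>4 5 6 7\<close>, because a 4-cycle is 2-choosable.
\<close>

section \<open>The graph\<close>

text \<open>Each edge appears in one direction only, so distinct pairs are distinct edges. The last
  four pairs join the face 0 2 1 3 to the face 4 5 6 7 in cyclic order.\<close>

definition cube :: "(nat \<times> nat) set" where
  "cube = {(0,2), (2,1), (1,3), (3,0), (4,5), (5,6), (6,7), (7,4), (0,4), (2,5), (1,6), (3,7)}"

text \<open>For \<open>k\<close> in 2..7 copy \<open>i\<close> occupies the block from
  \<open>6 * i + 2\<close> to \<open>6 * i + 7\<close>; nine such blocks and the two poles 0, 1 give
  56 vertices.\<close>

definition copy :: "nat \<Rightarrow> nat \<Rightarrow> nat" where
  "copy i k = (if k < 2 then k else 6 * i + k)"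

definition nine_cubes :: "nat pair_pre_digraph" where
  "nine_cubes = \<lparr>pverts = {..<56},
     parcs = {(copy i k, copy i l) | i k l. i < 9 \<and> ((k, l) \<in> cube \<or> (l, k) \<in> cube)}\<rparr>"

definition sgn_cubes :: "nat set \<Rightarrow> int" where
  "sgn_cubes e = (if \<exists>i<9. e = {copy i 4, copy i 7} then -1 else 1)"

lemma cube_less: "(k, l) \<in> cube \<Longrightarrow> k < 8 \<and> l < 8 \<and> k \<noteq> l"
  by (auto simp: cube_def)

lemma copy_less: "i < 9 \<Longrightarrow> k < 8 \<Longrightarrow> copy i k < 56"
  by (simp add: copy_def)

lemma copy_eq_iff:
  "k < 8 \<Longrightarrow> l < 8 \<Longrightarrow> copy i k = copy j l \<longleftrightarrow> k = l \<and> (k < 2 \<or> i = j)"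
  unfolding copy_def by (cases "k < 2"; cases "l < 2"; simp; presburger)

lemma copy_cases:
  assumes "n < 56"
  obtains i k where "i < 9" "k < 8" "n = copy i k"
proof (cases "n < 2")
  case True
  then show ?thesis by (intro that[of 0 n]) (auto simp: copy_def)
next
  case False
  have "n = copy ((n - 2) div 6) ((n - 2) mod 6 + 2)"
    using False mult_div_mod_eq[of 6 "n - 2"] by (simp add: copy_def)
  then show ?thesis using assms by (intro that) (auto simp: less_mult_imp_div_less)
qed

lemma pverts_nine_cubes: "pverts nine_cubes = {..<56}"
  by (simp add: nine_cubes_def)

lemma parcs_nine_cubes:
  "(u, v) \<in> parcs nine_cubes \<longleftrightarrow>
     (\<exists>i k l. i < 9 \<and> ((k, l) \<in> cube \<or> (l, k) \<in> cube) \<and> u = copy i k \<and> v = copy i l)"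
  by (auto simp: nine_cubes_def)

lemma edges_nine_cubes:
  "edges nine_cubes = {{copy i k, copy i l} | i k l. i < 9 \<and> (k, l) \<in> cube}"
  unfolding edges_def parcs_nine_cubes by (auto; metis insert_commute)

lemma parcs_nine_cubes_less: "(u, v) \<in> parcs nine_cubes \<Longrightarrow> u < 56 \<and> v < 56 \<and> u \<noteq> v"
  by (auto simp: parcs_nine_cubes copy_less copy_eq_iff dest!: cube_less)

lemma pair_graph_nine_cubes: "pair_graph nine_cubes"
proof
  show "finite (parcs nine_cubes)"
    by (rule finite_subset[of _ "{..<56} \<times> {..<56}"]) (auto dest: parcs_nine_cubes_less)
  show "symmetric (with_proj nine_cubes)"
    unfolding symmetric_def by (auto simp: sym_def parcs_nine_cubes)
qed (auto simp: pverts_nine_cubes dest: parcs_nine_cubes_less)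


section \<open>Girth\<close>

definition cube_side :: "nat \<Rightarrow> bool" where
  "cube_side k \<longleftrightarrow> k \<in> {0, 1, 5, 7}"

text \<open>Both poles lie on the same side of the bipartition \<open>cube_side\<close>, so the
  bipartitions of the nine cubes agree where the cubes are glued.\<close>

lemma nine_cubes_bipartite:
  "\<exists>side :: nat \<Rightarrow> bool. \<forall>(u, v) \<in> parcs nine_cubes. side u \<noteq> side v"
proof -
  define side where "side n \<longleftrightarrow> (\<exists>i k. k < 8 \<and> cube_side k \<and> n = copy i k)" for n
  have "side (copy i k) \<longleftrightarrow> cube_side k" if "k < 8" for i k
    using that by (auto simp: side_def copy_eq_iff)
  moreover have "cube_side k \<noteq> cube_side l" if "(k, l) \<in> cube" for k l
    using that by (auto simp: cube_side_def cube_def)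
  ultimately have "side u \<noteq> side v" if "(u, v) \<in> parcs nine_cubes" for u v
    using that cube_less unfolding parcs_nine_cubes by metis
  then show ?thesis by blast
qed

lemma girth_nine_cubes: "girth nine_cubes = 4"
proof (rule antisym)
  let ?p = "[(4, 5), (5, 6), (6, 7), (7, 4)] :: (nat \<times> nat) list"
  have "set ?p \<subseteq> parcs nine_cubes"
  proof -
    have "(k, l) \<in> parcs nine_cubes" if "(k, l) \<in> cube" for k l
    proof -
      have "(copy 0 k, copy 0 l) \<in> parcs nine_cubes" using that
        by (force simp only: parcs_nine_cubes intro: zero_less_numeral)
      moreover have "copy 0 n = n" for n by (simp add: copy_def)
      ultimately show ?thesis by simp
    qed
    then show ?thesis by (simp add: cube_def)
  qed
  then have "graph_cycle nine_cubes ?p"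
    unfolding graph_cycle_def pre_digraph.cycle_def pre_digraph.awalk_def
    by (auto simp: pverts_nine_cubes pre_digraph.cas.simps pre_digraph.awalk_verts.simps
             intro!: exI[of _ 4])
  then have "girth nine_cubes \<le> enat (length ?p)"
    unfolding girth_def by (intro INF_lower) simp
  then show "girth nine_cubes \<le> 4" by (simp add: numeral_eq_enat eval_nat_numeral)
next
  obtain side :: "nat \<Rightarrow> bool"
    where side: "\<And>u v. (u, v) \<in> parcs nine_cubes \<Longrightarrow> side u \<noteq> side v"
    using nine_cubes_bipartite by blast
  have "4 \<le> length p" if p: "graph_cycle nine_cubes p" for p
  proof (rule ccontr)
    assume "\<not> 4 \<le> length p"
    with p have "length p = 3" by (simp add: graph_cycle_def)
    then obtain e1 e2 e3 where "p = [e1, e2, e3]"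
      by (auto simp: numeral_3_eq_3 length_Suc_conv)
    with p obtain x y z where "{(x, y), (y, z), (z, x)} \<subseteq> parcs nine_cubes"
      unfolding graph_cycle_def pre_digraph.cycle_def pre_digraph.awalk_def
      by (cases e1; cases e2; cases e3) (auto simp: pre_digraph.cas.simps)
    then have "side x \<noteq> side y" "side y \<noteq> side z" "side z \<noteq> side x"
      using side by auto
    then show False by blast
  qed
  then show "4 \<le> girth nine_cubes"
    unfolding girth_def by (intro INF_greatest) (simp add: numeral_eq_enat)
qed


section \<open>List colorings\<close>

lemma signature_nine_cubes: "signature nine_cubes sgn_cubes"
  by (simp add: signature_def sgn_cubes_def)

lemma sgn_copy:
  assumes "i < 9" "k < 8" "l < 8" "2 \<le> l"
  shows "sgn_cubes {copy i k, copy i l} = (if {k, l} = {4, 7} then -1 else 1)"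
proof -
  have "(\<exists>j<9. {copy i k, copy i l} = {copy j 4, copy j 7}) \<longleftrightarrow> {k, l} = {4, 7}"
    using assms by (auto simp: doubleton_eq_iff copy_eq_iff)
  then show ?thesis by (simp add: sgn_cubes_def)
qed

text \<open>The cube with index \<open>i = 3 * p + q\<close> blocks the colors \<open>2 + p\<close> of \<open>0\<close> and \<open>5 + q\<close> of \<open>1\<close>.\<close>

definition cube_list :: "nat \<Rightarrow> nat \<Rightarrow> int set" where
  "cube_list i k =
     (let a = 2 + int (i div 3); b = 5 + int (i mod 3) in
      if k = 0 then {2, 3, 4} else if k = 1 then {5, 6, 7}
      else if k \<in> {2, 3} then {a, b, 8} else if k = 4 then {1, -1, a}
      else if k = 6 then {1, -1, b} else {1, -1, 8})"

lemma card_cube_list: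
  assumes "i < 9"
  shows "finite (cube_list i k) \<and> card (cube_list i k) = 3"
proof -
  have "i div 3 < 3" "i mod 3 < 3" using assms by auto
  then show ?thesis by (auto simp: cube_list_def Let_def card_insert_if)
qed

lemma not_signed_choosable_nine_cubes: "\<not> signed_choosable 3 nine_cubes sgn_cubes"
proof
  assume choosable: "signed_choosable 3 nine_cubes sgn_cubes"
  \<comment> \<open>Division by 6 inverts \<open>copy\<close> away from the poles; the lists of the
    poles are the same in all cubes, so index 0 serves for them.\<close>
  define L where "L n = (if n < 2 then cube_list 0 n
    else cube_list ((n - 2) div 6) ((n - 2) mod 6 + 2))" for n
  have L_copy: "L (copy i k) = cube_list i k" if "k < 8" for i k
  proof (cases "k < 2")
    case True
    then show ?thesis by (auto simp: L_def copy_def cube_list_def)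
  next
    case False
    define m where "m = k - 2"
    have "k = m + 2" "m < 6" using False that by (auto simp: m_def)
    then show ?thesis by (simp add: L_def copy_def)
  qed
  have "finite (L n) \<and> card (L n) = 3" if "n < 56" for n
    using copy_cases[OF that] L_copy card_cube_list by metis
  then have "k_list_assignment 3 nine_cubes L"
    unfolding k_list_assignment_def list_assignment_def pverts_nine_cubes
    by (metis card.empty lessThan_iff zero_neq_numeral)
  with choosable obtain c where c: "signed_proper_coloring nine_cubes sgn_cubes c"
    and c_list: "\<And>n. n < 56 \<Longrightarrow> c n \<in> L n"
    unfolding signed_choosable_def pverts_nine_cubes by auto
  have "c 0 \<in> {2, 3, 4}" "c 1 \<in> {5, 6, 7}"
    using c_list[of 0] c_list[of 1] by (auto simp: L_def cube_list_def)
  then obtain p q where pq: "p < 3" "c 0 = 2 + int p" "q < 3" "c 1 = 5 + int q"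
    by (intro that[of "nat (c 0 - 2)" "nat (c 1 - 5)"]) auto
  \<comment> \<open>The cube whose lists were made for the colors that \<open>c\<close> gives to the
    poles.\<close>
  define i where "i = 3 * p + q"
  have i: "i < 9" "i div 3 = p" "i mod 3 = q" using pq by (auto simp: i_def)
  define x where "x k = c (copy i k)" for k
  have x01: "x 0 = 2 + int p" "x 1 = 5 + int q"
    using pq by (auto simp: x_def copy_def)
  have x_list: "x k \<in> cube_list i k" if "k < 8" for k
    using c_list[OF copy_less[OF i(1) that]] L_copy[OF that] by (simp add: x_def)
  have x_arc: "x k \<noteq> (if {k, l} = {4, 7} then -1 else 1) * x l"
    if "(k, l) \<in> cube \<or> (l, k) \<in> cube" "2 \<le> l" for k l
  proof -
    have "(copy i k, copy i l) \<in> parcs nine_cubes"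
      using that i by (auto simp: parcs_nine_cubes)
    then have "x k \<noteq> sgn_cubes {copy i k, copy i l} * x l"
      using c by (auto simp: signed_proper_coloring_def x_def)
    moreover have "k < 8" "l < 8" using that cube_less by auto
    ultimately show ?thesis using sgn_copy[of i k l] that i by simp
  qed
  have x2: "x 2 = 8"
    using x_list[of 2] x_arc[of 0 2] x_arc[of 1 2] x01 i
    by (auto simp: cube_list_def cube_def doubleton_eq_iff)
  have x3: "x 3 = 8"
    using x_list[of 3] x_arc[of 0 3] x_arc[of 1 3] x01 i
    by (auto simp: cube_list_def cube_def doubleton_eq_iff)
  have x4: "x 4 \<in> {1, -1}"
    using x_list[of 4] x_arc[of 0 4] x01 i
    by (auto simp: cube_list_def cube_def doubleton_eq_iff)
  have x5: "x 5 \<in> {1, -1}"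
    using x_list[of 5] x_arc[of 2 5] x2
    by (auto simp: cube_list_def cube_def doubleton_eq_iff Let_def)
  have x6: "x 6 \<in> {1, -1}"
    using x_list[of 6] x_arc[of 1 6] x01 i
    by (auto simp: cube_list_def cube_def doubleton_eq_iff)
  have x7: "x 7 \<in> {1, -1}"
    using x_list[of 7] x_arc[of 3 7] x3
    by (auto simp: cube_list_def cube_def doubleton_eq_iff Let_def)
  \<comment> \<open>With values in 1, -1 the three positive edges force alternation and hence
    \<open>x 4 = - x 7\<close>, which the negative edge forbids.\<close>
  have "x 4 \<noteq> x 5" "x 5 \<noteq> x 6" "x 6 \<noteq> x 7" "x 4 \<noteq> - x 7"
    using x_arc[of 4 5] x_arc[of 5 6] x_arc[of 6 7] x_arc[of 4 7]
    by (auto simp: cube_def doubleton_eq_iff)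
  with x4 x5 x6 x7 show False by auto
qed

section \<open>Unsigned list colorings\<close>

lemma two_elements:
  assumes "2 \<le> card A"
  obtains x y where "x \<in> A" "y \<in> A" "x \<noteq> y"
  using assms card_le_Suc0_iff_eq[of A]
  by (metis One_nat_def Suc_1 card.infinite not_less_eq_eq zero_le)

text \<open>Keep two colors per vertex. If the four pairs coincide, alternate along the cycle.
  Otherwise some vertex has a color missing at a neighbor: use it and color greedily in the
  direction away from that neighbor, which comes last and loses at most one color.\<close>

lemma four_cycle_two_choosable:
  assumes "2 \<le> card A" "2 \<le> card B" "2 \<le> card C" "2 \<le> card D"
  obtains x y z t where "x \<in> A" "y \<in> B" "z \<in> C" "t \<in> D" "x \<noteq> y" "y \<noteq> z" "z \<noteq> t" "t \<noteq> x"
proof -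
  obtain a a' where "a \<in> A" "a' \<in> A" "a \<noteq> a'" using two_elements assms(1) by blast
  moreover obtain b b' where "b \<in> B" "b' \<in> B" "b \<noteq> b'" using two_elements assms(2) by blast
  moreover obtain c c' where "c \<in> C" "c' \<in> C" "c \<noteq> c'" using two_elements assms(3) by blast
  moreover obtain d d' where "d \<in> D" "d' \<in> D" "d \<noteq> d'" using two_elements assms(4) by blast
  ultimately show ?thesis using that by (smt (verit))
qed

text \<open>Of the colored vertices, 2 and 3 see only the poles, so a third color remains for each.
  Every vertex of 4 5 6 7 then has exactly one colored neighbor and keeps two colors. The poles are
  not adjacent, so \<open>a\<close> and \<open>b\<close> may be equal or not.\<close>

lemma cube_coloring_extends:
  fixes L :: "nat \<Rightarrow> 'c set"
  assumes L: "\<And>k. k < 8 \<Longrightarrow> finite (L k) \<and> card (L k) = 3"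
    and ab: "a \<in> L 0" "b \<in> L 1"
  obtains x where "x 0 = a" "x 1 = b" "\<And>k. k < 8 \<Longrightarrow> x k \<in> L k"
    "\<And>k l. (k, l) \<in> cube \<Longrightarrow> x k \<noteq> x l"
proof -
  have pick: "\<exists>s \<in> L k. s \<noteq> a \<and> s \<noteq> b" if "k < 8" for k
  proof -
    have "card {a, b} \<le> 2" by (simp add: card_insert_if)
    then have "0 < card (L k - {a, b})"
      using L[OF that] diff_card_le_card_Diff[of "{a, b}" "L k"] by simp
    then have "L k - {a, b} \<noteq> {}" by (metis card.empty less_irrefl)
    then show ?thesis by blast
  qed
  have shrink: "2 \<le> card (L k - {s})" if "k < 8" for k s
    using L[OF that] by (simp add: card_Diff_singleton_if)
  obtain s2 where s2: "s2 \<in> L 2" "s2 \<noteq> a" "s2 \<noteq> b" using pick[of 2] by auto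
  obtain s3 where s3: "s3 \<in> L 3" "s3 \<noteq> a" "s3 \<noteq> b" using pick[of 3] by auto
  obtain s4 s5 s6 s7 where s: "s4 \<in> L 4 - {a}" "s5 \<in> L 5 - {s2}" "s6 \<in> L 6 - {b}"
      "s7 \<in> L 7 - {s3}" "s4 \<noteq> s5" "s5 \<noteq> s6" "s6 \<noteq> s7" "s7 \<noteq> s4"
    by (rule four_cycle_two_choosable[of "L 4 - {a}" "L 5 - {s2}" "L 6 - {b}" "L 7 - {s3}"])
      (simp_all add: shrink)
  define x where "x k = [a, b, s2, s3, s4, s5, s6, s7] ! k" for k
  have "x k \<in> L k" if "k < 8" for k
  proof -
    have "k \<in> {0, 1, 2, 3, 4, 5, 6, 7}" using that by auto
    then show ?thesis using ab s s2 s3 by (auto simp: x_def)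
  qed
  moreover have "x k \<noteq> x l" if "(k, l) \<in> cube" for k l
    using that s s2 s3 by (auto simp: x_def cube_def)
  ultimately show ?thesis using that[of x] by (simp add: x_def)
qed

lemma choosable_nine_cubes: "choosable 3 nine_cubes"
  unfolding choosable_def
proof (intro allI impI)
  fix L :: "nat \<Rightarrow> int set"
  assume "k_list_assignment 3 nine_cubes L"
  then have L: "finite (L n) \<and> card (L n) = 3" if "n < 56" for n
    using that by (simp add: k_list_assignment_def pverts_nine_cubes)
  have "L 0 \<noteq> {}" "L 1 \<noteq> {}" using L[of 0] L[of 1] by auto
  then obtain a b where ab: "a \<in> L 0" "b \<in> L 1" by blast
  \<comment> \<open>Once the poles are colored, the nine cubes can be colored independently.\<close>
  have "\<exists>x. x 0 = a \<and> x 1 = b \<and> (\<forall>k<8. x k \<in> L (copy i k)) \<and>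
          (\<forall>(k, l) \<in> cube. x k \<noteq> x l)" if "i < 9" for i
  proof -
    have "finite (L (copy i k)) \<and> card (L (copy i k)) = 3" if "k < 8" for k
      using L copy_less \<open>i < 9\<close> that by blast
    moreover have "a \<in> L (copy i 0)" "b \<in> L (copy i 1)" using ab by (auto simp: copy_def)
    ultimately obtain x where "x 0 = a" "x 1 = b" "\<And>k. k < 8 \<Longrightarrow> x k \<in> L (copy i k)"
        "\<And>k l. (k, l) \<in> cube \<Longrightarrow> x k \<noteq> x l"
      by (rule cube_coloring_extends[of "\<lambda>k. L (copy i k)" a b]) blast+
    then show ?thesis by blast
  qed
  then obtain x where x: "\<And>i. i < 9 \<Longrightarrow> x i 0 = a \<and> x i 1 = b \<and>
      (\<forall>k<8. x i k \<in> L (copy i k)) \<and> (\<forall>(k, l) \<in> cube. x i k \<noteq> x i l)"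
    by metis
  \<comment> \<open>All \<open>x i\<close> agree on the poles, so reading their colors from cube 0
    is consistent.\<close>
  define c where "c n = (if n < 2 then x 0 n else x ((n - 2) div 6) ((n - 2) mod 6 + 2))" for n
  have c_copy: "c (copy i k) = x i k" if "i < 9" "k < 8" for i k
  proof (cases "k < 2")
    case True
    then have "k = 0 \<or> k = 1" by auto
    then show ?thesis using x[of 0] x[of i] that by (auto simp: c_def copy_def)
  next
    case False
    define m where "m = k - 2"
    have "k = m + 2" "m < 6" using False that by (auto simp: m_def)
    then show ?thesis by (simp add: c_def copy_def)
  qed
  have "proper_coloring nine_cubes c"
    unfolding proper_coloring_def
  proof clarify
    fix u v assume "(u, v) \<in> parcs nine_cubes" "c u = c v"
    then obtain i k l where *: "i < 9" "(k, l) \<in> cube \<or> (l, k) \<in> cube"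
        "u = copy i k" "v = copy i l"
      by (auto simp: parcs_nine_cubes)
    then have "x i k = x i l" using \<open>c u = c v\<close> c_copy cube_less by metis
    then show False using * x[of i] by fastforce
  qed
  moreover have "c n \<in> L n" if "n < 56" for n
    using copy_cases[OF that] c_copy x by metis
  ultimately show "\<exists>c. proper_coloring nine_cubes c \<and> (\<forall>v \<in> pverts nine_cubes. c v \<in> L v)"
    by (auto simp: pverts_nine_cubes)
qed


section \<open>Planarity\<close>

text \<open>Twice the signed area of the triangle \<open>a b c\<close>; its sign tells on which side
  of the line \<open>a b\<close> the point \<open>c\<close> lies.\<close>

definition orient :: "complex \<Rightarrow> complex \<Rightarrow> complex \<Rightarrow> real" where
  "orient a b c = (Re b - Re a) * (Im c - Im a) - (Im b - Im a) * (Re c - Re a)"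

lemma orient_segment:
  "orient a b ((1 - t) *\<^sub>R c + t *\<^sub>R d) = (1 - t) * orient a b c + t * orient a b d"
  by (simp add: orient_def algebra_simps)

lemma orient_on_segment: "z \<in> closed_segment a b \<Longrightarrow> orient a b z = 0"
  by (auto simp: in_segment orient_segment) (simp add: orient_def algebra_simps)

lemma convex_combination_nonzero:
  fixes r s t :: real
  assumes "r * s > 0" "0 \<le> t" "t \<le> 1"
  shows "(1 - t) * r + t * s \<noteq> 0"
proof -
  consider "r > 0" "s > 0" | "r < 0" "s < 0"
    using assms(1) by (auto simp: zero_less_mult_iff)
  then show ?thesis
  proof cases
    case 1
    then show ?thesis using convex_bound_lt[of "- r" 0 "- s" "1 - t" t] assms by simp
  next
    case 2
    then show ?thesis using convex_bound_lt[of r 0 s "1 - t" t] assms by simp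
  qed
qed

lemma open_convex_combination_nonzero:
  fixes r s t :: real
  assumes "r * s \<ge> 0" "r + s \<noteq> 0" "0 < t" "t < 1"
  shows "(1 - t) * r + t * s \<noteq> 0"
proof (cases "r * s = 0")
  case True
  then show ?thesis using assms by auto
next
  case False
  then have "r * s > 0" using assms(1) by linarith
  then show ?thesis using assms convex_combination_nonzero[of r s t] by simp
qed

text \<open>Either the open segment \<open>a b\<close> misses the line \<open>c d\<close>, or the
  closed segment \<open>c d\<close> misses the line \<open>a b\<close>. The weak inequality in the
  first alternative admits edges with a common end.\<close>

definition noncrossing :: "complex \<Rightarrow> complex \<Rightarrow> complex \<Rightarrow> complex \<Rightarrow> bool" where
  "noncrossing a b c d \<longleftrightarrow>
     orient c d a * orient c d b \<ge> 0 \<and> orient c d a + orient c d b \<noteq> 0 \<or>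
     orient a b c * orient a b d > 0"

lemma noncrossing_imp_disjoint:
  assumes "noncrossing a b c d"
  shows "open_segment a b \<inter> closed_segment c d = {}"
proof (rule ccontr)
  assume "\<not> ?thesis"
  then obtain z where z: "z \<in> open_segment a b" "z \<in> closed_segment c d" by blast
  from z(1) obtain t where t: "0 < t" "t < 1" "z = (1 - t) *\<^sub>R a + t *\<^sub>R b"
    by (auto simp: in_segment)
  from z(2) obtain s where s: "0 \<le> s" "s \<le> 1" "z = (1 - s) *\<^sub>R c + s *\<^sub>R d"
    by (auto simp: in_segment)
  have "z \<in> closed_segment a b" using z(1) by (simp add: open_segment_def)
  then have "(1 - s) * orient a b c + s * orient a b d = 0"
    using orient_on_segment s(3) orient_segment by metis
  moreover have "(1 - t) * orient c d a + t * orient c d b = 0"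
    using orient_on_segment[OF z(2)] t(3) orient_segment by metis
  ultimately show False
    using assms[unfolded noncrossing_def] t s convex_combination_nonzero open_convex_combination_nonzero by metis
qed

text \<open>The outer quadrilateral is 0 2 1 3, with the poles at -8i and 8i. Vertex 7 is put off
  the real axis: at the point 5 the edges 2 5 and 3 7 would be collinear, which
  \<open>noncrossing\<close> does not accept.\<close>

definition cube_pt :: "nat \<Rightarrow> complex" where
  "cube_pt = (!) [Complex 0 (-8), Complex 0 8, Complex 1 0, Complex 7 0,
                Complex 4 (-1), Complex 3 0, Complex 4 1, Complex 5 1]"

lemma inj_on_cube_pt: "inj_on cube_pt {..<8}"
  unfolding cube_pt_def by (rule inj_on_nth) (simp_all add: complex_eq_iff)

lemma cube_segments_disjoint:
  assumes "(k, l) \<in> cube" "(k', l') \<in> cube" "(k, l) \<noteq> (k', l')"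
  shows "open_segment (cube_pt k) (cube_pt l) \<inter> closed_segment (cube_pt k') (cube_pt l') = {}"
proof -
  \<comment> \<open>Evaluated on all 12 * 11 ordered pairs; the order matters because only the first
    segment is open.\<close>
  have "\<forall>(k, l) \<in> cube. \<forall>(k', l') \<in> cube. (k, l) \<noteq> (k', l') \<longrightarrow>
      noncrossing (cube_pt k) (cube_pt l) (cube_pt k') (cube_pt l')"
    unfolding cube_def by (simp, simp add: cube_pt_def, simp add: noncrossing_def orient_def)
  then show ?thesis using assms noncrossing_imp_disjoint by fast
qed

text \<open>A pole has several edges, so it is an end of some segment other than \<open>k l\<close>,
  and the interior of \<open>k l\<close> avoids that closed segment.\<close>

lemma poles_notin_open_segment:
  assumes "(k, l) \<in> cube" "j < 2"
  shows "cube_pt j \<notin> open_segment (cube_pt k) (cube_pt l)"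
proof -
  have "\<exists>m. (j, m) \<in> cube \<and> (j, m) \<noteq> (k, l)"
  proof (cases "j = 0")
    case True
    have "(0, 2) \<in> cube" "(0, 4) \<in> cube" by (auto simp: cube_def)
    then show ?thesis using True by (cases "l = 2") force+
  next
    case False
    then have "j = 1" using assms by simp
    moreover have "(1, 3) \<in> cube" "(1, 6) \<in> cube" by (auto simp: cube_def)
    ultimately show ?thesis by (cases "l = 3") force+
  qed
  then show ?thesis using cube_segments_disjoint[OF assms(1)] by blast
qed

section \<open>Disjoint placement of the nine copies\<close>

text \<open>
  The cube is drawn inside the triangle with corners \<open>-8\<i>\<close>, \<open>8\<i>\<close> and \<open>8\<close>. The maps \<open>shear i\<close>
  fix the two corners \<open>\<plusminus>8\<i>\<close> and move the triangle to regions that are disjoint apart from these.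
\<close>

definition cube_region :: "complex set" where
  "cube_region = {z. 0 \<le> Re z \<and> \<bar>Im z\<bar> \<le> 8 - Re z}"

definition shear :: "nat \<Rightarrow> complex \<Rightarrow> complex" where
  "shear i z = Complex (Re z + 2 * real i * (8 - \<bar>Im z\<bar>)) (Im z)"

lemma inj_shear: "inj (shear i)"
  by (auto simp: inj_def shear_def complex_eq_iff)

lemma continuous_on_shear: "continuous_on S (shear i)"
  unfolding shear_def Complex_eq by (intro continuous_intros)

lemma shear_pole: "j < 2 \<Longrightarrow> shear i (cube_pt j) = cube_pt j"
  by (auto simp: less_2_cases_iff shear_def cube_pt_def)

text \<open>At height \<open>y\<close> the region is the interval from 0 to
  \<open>t = 8 - |y|\<close>, and \<open>shear i\<close> moves it to the interval from
  \<open>2 * i * t\<close> to \<open>2 * i * t + t\<close>. For different \<open>i\<close> these are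
  disjoint unless \<open>t = 0\<close>, that is, at a pole.\<close>

lemma shear_eq_imp_pole:
  assumes eq: "shear i z = shear j w" and "i \<noteq> j" and z: "z \<in> cube_region" and w: "w \<in> cube_region"
  obtains k where "k < 2" "z = cube_pt k" "w = cube_pt k"
proof -
  define t where "t = 8 - \<bar>Im z\<bar>"
  have im: "Im w = Im z" and re: "Re z + 2 * real i * t = Re w + 2 * real j * t"
    using eq by (auto simp: shear_def t_def)
  have bounds: "0 \<le> Re z" "Re z \<le> t" "0 \<le> Re w" "Re w \<le> t"
    using z w im by (auto simp: cube_region_def t_def)
  have "2 * (real i - real j) * t = Re w - Re z" using re by (simp add: algebra_simps)
  then have "\<bar>2 * (real i - real j) * t\<bar> \<le> t" using bounds by simp
  then have "2 * \<bar>real i - real j\<bar> * t \<le> t"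
    using bounds by (simp only: abs_mult abs_of_nonneg abs_numeral)
  moreover have "1 * t \<le> \<bar>real i - real j\<bar> * t"
    using \<open>i \<noteq> j\<close> bounds by (intro mult_right_mono) auto
  ultimately have "t = 0" using bounds by linarith
  then have "Re z = 0" "Re w = 0" "Im z = 8 \<or> Im z = -8" using bounds by (auto simp: t_def)
  then have "z = cube_pt 1 \<and> w = cube_pt 1 \<or> z = cube_pt 0 \<and> w = cube_pt 0"
    using im by (auto simp: cube_pt_def complex_eq_iff)
  then show ?thesis using that[of 0] that[of 1] by auto
qed

lemma convex_region: "convex cube_region"
proof -
  have eq: "cube_region = {z. Re z \<ge> 0} \<inter> {z. Re z + Im z \<le> 8} \<inter> {z. Re z - Im z \<le> 8}"
    by (auto simp: cube_region_def)
  have "convex {z. Re z + Im z \<le> 8}" "convex {z. Re z - Im z \<le> 8}"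
    using convex_halfspace_le[of "Complex 1 1" 8] convex_halfspace_le[of "Complex 1 (-1)" 8]
    by (simp_all add: inner_complex_def)
  then show ?thesis
    unfolding eq by (intro convex_Int) (simp_all add: convex_halfspace_Re_ge)
qed

lemma cube_pt_in_region: "k < 8 \<Longrightarrow> cube_pt k \<in> cube_region"
proof -
  assume "k < 8"
  then have "k \<in> {0, 1, 2, 3, 4, 5, 6, 7}" by auto
  then show ?thesis by (auto simp: cube_pt_def cube_region_def)
qed

lemma cube_segment_in_region:
  "k < 8 \<Longrightarrow> l < 8 \<Longrightarrow> closed_segment (cube_pt k) (cube_pt l) \<subseteq> cube_region"
  using closed_segment_subset convex_region cube_pt_in_region by blast

text \<open>Within one copy this is the case of a single cube, as \<open>shear i\<close> is
  injective. Different copies can meet only in a pole, which is not interior to any edge.\<close>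

lemma sheared_segments_disjoint:
  assumes kl: "(k, l) \<in> cube" and kl': "(k', l') \<in> cube"
    and ne: "{copy i k, copy i l} \<noteq> {copy j k', copy j l'}"
  shows "shear i ` open_segment (cube_pt k) (cube_pt l) \<inter>
         shear j ` closed_segment (cube_pt k') (cube_pt l') = {}"
proof (cases "i = j")
  case True
  then have "(k, l) \<noteq> (k', l')" using ne by auto
  then show ?thesis
    using cube_segments_disjoint[OF kl kl'] True inj_shear[of i]
    by (auto simp: image_Int[symmetric])
next
  case False
  show ?thesis
  proof (rule ccontr)
    assume "\<not> ?thesis"
    then obtain z w where zw: "z \<in> open_segment (cube_pt k) (cube_pt l)"
        "w \<in> closed_segment (cube_pt k') (cube_pt l')" "shear i z = shear j w"
      by auto
    then have "z \<in> cube_region" "w \<in> cube_region"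
      using cube_segment_in_region cube_less[OF kl] cube_less[OF kl']
      by (auto simp: open_segment_def)
    then show False
      using shear_eq_imp_pole[OF zw(3) False] poles_notin_open_segment[OF kl] zw(1) by metis
  qed
qed

text \<open>Serves to derive that edge interiors avoid vertices from the fact that they avoid other
  edges. The directions chosen in \<open>cube\<close> make every vertex a first component.\<close>

lemma nine_cubes_no_isolated_vertex:
  assumes "n < 56"
  obtains f where "f \<in> edges nine_cubes" "n \<in> f"
proof -
  obtain i k where ik: "i < 9" "k < 8" "n = copy i k" using copy_cases[OF assms] by blast
  have "k \<in> {0, 1, 2, 3, 4, 5, 6, 7}" using ik by auto
  then have "\<exists>l. (k, l) \<in> cube" by (auto simp: cube_def)
  then obtain l where "(k, l) \<in> cube" by blast
  then have "{copy i k, copy i l} \<in> edges nine_cubes" using ik by (auto simp: edges_nine_cubes)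
  then show ?thesis using that ik by blast
qed

lemma planar_nine_cubes: "planar nine_cubes"
proof -
  define pt where "pt n = (if n < 2 then cube_pt n
    else shear ((n - 2) div 6) (cube_pt ((n - 2) mod 6 + 2)))" for n
  have pt_copy: "pt (copy i k) = shear i (cube_pt k)" if "k < 8" for i k
  proof (cases "k < 2")
    case True
    then show ?thesis by (simp add: pt_def copy_def shear_pole)
  next
    case False
    define m where "m = k - 2"
    have "k = m + 2" "m < 6" using False that by (auto simp: m_def)
    then show ?thesis by (simp add: pt_def copy_def)
  qed
  have inj: "inj_on pt (pverts nine_cubes)"
  proof (rule inj_onI)
    fix m n assume "m \<in> pverts nine_cubes" "n \<in> pverts nine_cubes" and eq: "pt m = pt n"
    then obtain i k j l where ik: "k < 8" "m = copy i k" and jl: "l < 8" "n = copy j l"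
      using copy_cases by (metis lessThan_iff pverts_nine_cubes)
    have sh: "shear i (cube_pt k) = shear j (cube_pt l)" using eq ik jl pt_copy by simp
    show "m = n"
    proof (cases "i = j")
      case True
      then have "cube_pt k = cube_pt l" using sh inj_shear[of i] by (auto dest: injD)
      then show ?thesis using inj_on_cube_pt ik jl True by (auto dest: inj_onD)
    next
      case False
      obtain h where "h < 2" "cube_pt k = cube_pt h" "cube_pt l = cube_pt h"
        using shear_eq_imp_pole[OF sh False] cube_pt_in_region ik jl by blast
      then have "k = h" "l = h" using inj_on_cube_pt ik jl by (auto dest: inj_onD)
      then show ?thesis using ik jl \<open>h < 2\<close> by (simp add: copy_def)
    qed
  qed
  \<comment> \<open>Drawings are indexed by unordered pairs, so a copy and a direction are chosen
    for each edge.\<close>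
  have "\<forall>e \<in> edges nine_cubes. \<exists>i k l. (k, l) \<in> cube \<and> e = {copy i k, copy i l}"
    by (auto simp: edges_nine_cubes)
  then obtain I K M where e: "\<And>e. e \<in> edges nine_cubes \<Longrightarrow>
      (K e, M e) \<in> cube \<and> e = {copy (I e) (K e), copy (I e) (M e)}"
    by metis
  \<comment> \<open>\<open>shear\<close> bends at the real axis when its index is positive, so these
    arcs need not be straight.\<close>
  define \<gamma> where "\<gamma> e = shear (I e) \<circ> linepath (cube_pt (K e)) (cube_pt (M e))" for e
  have image: "path_image (\<gamma> e) = shear (I e) ` closed_segment (cube_pt (K e)) (cube_pt (M e))" for e
    by (simp add: \<gamma>_def path_image_compose)
  have pt_e: "pt ` e = shear (I e) ` {cube_pt (K e), cube_pt (M e)}" if "e \<in> edges nine_cubes" for e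
  proof -
    have "pt ` {copy (I e) (K e), copy (I e) (M e)} = shear (I e) ` {cube_pt (K e), cube_pt (M e)}"
      proof -
      have "K e < 8" "M e < 8" using cube_less e[OF that] by auto
      then show ?thesis by (simp add: pt_copy)
    qed
    then show ?thesis using e[OF that] by simp
  qed
  have interior: "path_image (\<gamma> e) - pt ` e = shear (I e) ` open_segment (cube_pt (K e)) (cube_pt (M e))"
    if "e \<in> edges nine_cubes" for e
    unfolding image pt_e[OF that] open_segment_def using inj_shear by (simp add: image_set_diff)
  have arc: "arc (\<gamma> e) \<and> {pathstart (\<gamma> e), pathfinish (\<gamma> e)} = pt ` e"
    if "e \<in> edges nine_cubes" for e
  proof -
    have "cube_pt (K e) \<noteq> cube_pt (M e)"
      using cube_less e[OF that] inj_on_cube_pt by (metis inj_onD lessThan_iff)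
    then have "arc (linepath (cube_pt (K e)) (cube_pt (M e)))" by (rule arc_linepath)
    then have "arc (\<gamma> e)"
      unfolding arc_def \<gamma>_def
      by (auto intro!: path_continuous_image continuous_on_shear comp_inj_on
               intro: inj_on_subset[OF inj_shear])
    then show ?thesis
      unfolding pt_e[OF that] by (simp add: \<gamma>_def pathstart_compose pathfinish_compose)
  qed
  have disjoint: "(path_image (\<gamma> e) - pt ` e) \<inter> path_image (\<gamma> f) = {}"
    if "e \<in> edges nine_cubes" "f \<in> edges nine_cubes" "e \<noteq> f" for e f
  proof -
    have "{copy (I g) (K g), copy (I g) (M g)} = g" if "g \<in> edges nine_cubes" for g
      using e[OF that] by simp
    then have "{copy (I e) (K e), copy (I e) (M e)} \<noteq> {copy (I f) (K f), copy (I f) (M f)}"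
      using that by simp
    then show ?thesis
      unfolding interior[OF that(1)] unfolding image
      using e[OF that(1)] e[OF that(2)] by (intro sheared_segments_disjoint) auto
  qed
  have "(path_image (\<gamma> e) - pt ` e) \<inter> pt ` pverts nine_cubes = {}"
    if "e \<in> edges nine_cubes" for e
  proof (rule ccontr)
    assume "\<not> ?thesis"
    then obtain n where n: "n < 56" "pt n \<in> path_image (\<gamma> e) - pt ` e"
      by (auto simp: pverts_nine_cubes)
    \<comment> \<open>A vertex inside \<open>e\<close> is not an end of \<open>e\<close>, so an edge
      \<open>f\<close> at this vertex differs from \<open>e\<close> and would meet the interior of
      \<open>e\<close>.\<close>
    obtain f where f: "f \<in> edges nine_cubes" "n \<in> f"
      using nine_cubes_no_isolated_vertex[OF n(1)] by blast
    then have "f \<noteq> e" using n(2) by blast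
    have "pt n \<in> path_image (\<gamma> f)"
      using f arc[of f] pathstart_in_path_image pathfinish_in_path_image
      by (metis image_eqI insertE singletonD)
    then show False using disjoint[OF that f(1)] \<open>f \<noteq> e\<close> n by blast
  qed
  with inj arc disjoint show ?thesis
    unfolding planar_def plane_embedding_def by blast
qed

theorem theorem4p2:
  shows "\<exists>(G :: nat pair_pre_digraph) (\<sigma> :: nat set \<Rightarrow> int).
           pair_graph G \<and> planar G \<and> girth G = 4 \<and> signature G \<sigma> \<and>
           \<not> signed_choosable 3 G \<sigma> \<and> choosable 3 G"
  using pair_graph_nine_cubes planar_nine_cubes girth_nine_cubes signature_nine_cubes
    not_signed_choosable_nine_cubes choosable_nine_cubes
  by blast

end
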